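(* Let $X$ be a locally convex space, let $T:X\rightrightarrows X^{*}$, and let $C\subset X$ be closed and convex with $D(T)\cap\operatorname{int}C\neq\emptyset$. If $T$ is $C$-representable, then the following are equivalent: (i) $C$ locates $T$; (ii) $T$ is $C$-NI; (iii) $[\varphi_{T|_{C}}\le c]\cap(C\times X^{*})\subset T+N_{C}$; (iv) $C$ identifies $T+N_{C}$.
   Context: $(X,\tau)$ is a non-trivial Hausdorff locally convex space, $X^*$ its dual with weak-star topology $\omega^*$, $Z=X\times X^*$ with topology $\tau\times\omega^*$, $c(x,x^* )=\langle x,x^*\rangle$. Operators are identified with their graphs; $D(T)$ is the domain; $T|_V$ has graph $\operatorname{Graph}T\cap(V\times X^* )$. $N_C(x)=\{x^*\mid\langle y-x,x^*\rangle\le0\ \forall y\in C\}$ for $x\in C$, $\emptyset$ otherwise; $(T+N_C)(x)=Tx+N_C(x)$. $\varphi_{T}(x,x^{*})=\sup\{\langle x,u^{*}\rangle+\langle u,x^{*}\rangle-\langle u,u^{*}\rangle\mid(u,u^{*})\in T\}$ ($\sup\emptyset=-\infty$); $[f\le g]=\{z\mid f(z)\le g(z)\}$. $T$ is $V$-representable if $V\cap D(T)\ne\emptyset$ and there is a proper convex $\tau\times\omega^*$-lsc $h\ge c$ with $\{z\in V\times X^*\mid h(z)=c(z)\}=\operatorname{Graph}(T|_V)$. $V$ locates $S$ if $\operatorname{Pr}_X([\varphi_{S|_V}\le c])\cap V\subset D(S)$; $V$ identifies $S$ if $[\varphi_{S|_V}\le c]\cap(V\times X^* )\subset\operatorname{Graph}S$;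 $S$ is $V$-NI if $\varphi_{S|_V}\ge c$ on $V\times X^*$. *)

theory Defs
  imports "HOL-Analysis.Analysis"
begin

text \<open>X is modelled by a type 'a of class real_vector together with a topology tau
  on it (whole type as carrier). Elements of the dual are real-valued functions on 'a.\<close>

definition lcs :: "'a::real_vector topology \<Rightarrow> bool" where
  "lcs tau \<longleftrightarrow> topspace tau = UNIV
     \<and> continuous_map (prod_topology tau tau) tau (\<lambda>(x,y). x + y)
     \<and> continuous_map (prod_topology euclideanreal tau) tau (\<lambda>(a,x). a *\<^sub>R x)
     \<and> Hausdorff_space tau
     \<and> (\<forall>x U. openin tau U \<and> x \<in> U \<longrightarrow> (\<exists>W. openin tau W \<and> convex W \<and> x \<in> W \<and> W \<subseteq> U))"

definition dual :: "'a::real_vector topology \<Rightarrow> ('a \<Rightarrow> real) set" where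
  "dual tau = {f. linear f \<and> continuous_map tau euclideanreal f}"

definition weak_star :: "'a::real_vector topology \<Rightarrow> ('a \<Rightarrow> real) topology" where
  "weak_star tau = subtopology (product_topology (\<lambda>_. euclideanreal) UNIV) (dual tau)"

definition Ztop :: "'a::real_vector topology \<Rightarrow> ('a \<times> ('a \<Rightarrow> real)) topology" where
  "Ztop tau = prod_topology tau (weak_star tau)"

definition Zspace :: "'a::real_vector topology \<Rightarrow> ('a \<times> ('a \<Rightarrow> real)) set" where
  "Zspace tau = UNIV \<times> dual tau"

definition cpl :: "'a \<times> ('a \<Rightarrow> real) \<Rightarrow> real" where
  "cpl z = snd z (fst z)"

definition proper_fun :: "'a::real_vector topology \<Rightarrow> ('a \<times> ('a \<Rightarrow> real) \<Rightarrow> ereal) \<Rightarrow> bool" where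
  "proper_fun tau h \<longleftrightarrow> (\<forall>z\<in>Zspace tau. h z \<noteq> -\<infinity>) \<and> (\<exists>z\<in>Zspace tau. h z \<noteq> \<infinity>)"

definition convex_fun :: "'a::real_vector topology \<Rightarrow> ('a \<times> ('a \<Rightarrow> real) \<Rightarrow> ereal) \<Rightarrow> bool" where
  "convex_fun tau h \<longleftrightarrow> (\<forall>z1\<in>Zspace tau. \<forall>z2\<in>Zspace tau. \<forall>t::real. 0 < t \<and> t < 1 \<longrightarrow>
      h (t *\<^sub>R fst z1 + (1 - t) *\<^sub>R fst z2, (\<lambda>y. t * snd z1 y + (1 - t) * snd z2 y))
        \<le> ereal t * h z1 + ereal (1 - t) * h z2)"

definition lsc_fun :: "'a::real_vector topology \<Rightarrow> ('a \<times> ('a \<Rightarrow> real) \<Rightarrow> ereal) \<Rightarrow> bool" where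
  "lsc_fun tau h \<longleftrightarrow> (\<forall>r::ereal. closedin (Ztop tau) {z \<in> Zspace tau. h z \<le> r})"

type_synonym 'a op = "('a \<times> ('a \<Rightarrow> real)) set"

definition dom_op :: "'a op \<Rightarrow> 'a set" where
  "dom_op T = fst ` T"

definition restr :: "'a op \<Rightarrow> 'a set \<Rightarrow> 'a op" where
  "restr T V = T \<inter> (V \<times> UNIV)"

text \<open>Fitzpatrick-type function; Sup of the empty set in ereal is -\<infinity>.\<close>
definition phi :: "'a::real_vector op \<Rightarrow> 'a \<times> ('a \<Rightarrow> real) \<Rightarrow> ereal" where
  "phi T z = (SUP p\<in>T. ereal (snd z (fst p) + snd p (fst z) - snd p (fst p)))"

definition le_c :: "'a::real_vector topology \<Rightarrow> ('a \<times> ('a \<Rightarrow> real) \<Rightarrow> ereal) \<Rightarrow> ('a \<times> ('a \<Rightarrow> real)) set" where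
  "le_c tau f = {z \<in> Zspace tau. f z \<le> ereal (cpl z)}"

definition normal_cone :: "'a::real_vector topology \<Rightarrow> 'a set \<Rightarrow> 'a \<Rightarrow> ('a \<Rightarrow> real) set" where
  "normal_cone tau C x = (if x \<in> C then {u \<in> dual tau. \<forall>y\<in>C. u (y - x) \<le> 0} else {})"

definition plus_normal :: "'a::real_vector topology \<Rightarrow> 'a op \<Rightarrow> 'a set \<Rightarrow> 'a op" where
  "plus_normal tau T C = {(x, \<lambda>y. u y + v y) | x u v. (x, u) \<in> T \<and> v \<in> normal_cone tau C x}"

definition representable :: "'a::real_vector topology \<Rightarrow> 'a set \<Rightarrow> 'a op \<Rightarrow> bool" where
  "representable tau V T \<longleftrightarrow> V \<inter> dom_op T \<noteq> {} \<and>
     (\<exists>h. proper_fun tau h \<and> convex_fun tau h \<and> lsc_fun tau h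
          \<and> (\<forall>z\<in>Zspace tau. ereal (cpl z) \<le> h z)
          \<and> {z \<in> V \<times> dual tau. h z = ereal (cpl z)} = restr T V)"

definition locates :: "'a::real_vector topology \<Rightarrow> 'a set \<Rightarrow> 'a op \<Rightarrow> bool" where
  "locates tau V S \<longleftrightarrow> fst ` le_c tau (phi (restr S V)) \<inter> V \<subseteq> dom_op S"

definition identifies :: "'a::real_vector topology \<Rightarrow> 'a set \<Rightarrow> 'a op \<Rightarrow> bool" where
  "identifies tau V S \<longleftrightarrow> le_c tau (phi (restr S V)) \<inter> (V \<times> dual tau) \<subseteq> S"

definition NI :: "'a::real_vector topology \<Rightarrow> 'a set \<Rightarrow> 'a op \<Rightarrow> bool" where
  "NI tau V S \<longleftrightarrow> (\<forall>z \<in> V \<times> dual tau. ereal (cpl z) \<le> phi (restr S V) z)"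

end

theory Submission
  imports Defs "HOL-Library.Function_Algebras"
begin

text \<open>The only deep implication is (ii) \<open>\<Longrightarrow>\<close> (iii). Let \<open>h\<close> represent \<open>T\<close> on \<open>C\<close> and let \<open>z = (x, \<zeta>)\<close>
  satisfy \<open>x \<in> C\<close> and \<open>\<phi>(z) \<le> c(z)\<close>, where \<open>\<phi>\<close> is the Fitzpatrick function of \<open>T\<close> restricted to \<open>C\<close>.
  By (ii), \<open>\<phi> \<ge> c\<close> on \<open>C \<times> X\<^sup>*\<close> with contact at \<open>z\<close>, so \<open>\<phi>(w) \<ge> \<langle>z, w\<rangle> - c(z)\<close> for all
  \<open>w \<in> C \<times> X\<^sup>*\<close>; moreover \<open>\<phi>\<close> lies below the conjugate \<open>h\<^sup>*\<close>. Hence \<open>\<langle>z, w\<rangle> - h\<^sup>*(w) \<le> c(z)\<close> on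
  \<open>C \<times> X\<^sup>*\<close>, and the point of \<open>D(T)\<close> in the interior of \<open>C\<close> yields a Lagrange multiplier \<open>n \<in> X\<^sup>*\<close>
  for the constraint \<open>C\<close>. With \<open>h\<^sup>*\<^sup>* = h\<close> this reads \<open>h(x, \<zeta> - n) \<le> c(z) - n(y)\<close> for all
  \<open>y \<in> C\<close>. Taking \<open>y = x\<close> and using \<open>h \<ge> c\<close> gives \<open>\<zeta> - n \<in> T x\<close>, and then general \<open>y\<close> gives
  \<open>n \<in> N\<^sub>C(x)\<close>.\<close>

section \<open>Hahn--Banach separation\<close>

text \<open>Only an inequality for positive factors is required, which lightens the verification for
  constructed functionals. Applying it to \<open>t\<close> and to \<open>inverse t\<close> recovers
  equality; the factors 2 and 1/2 give the value at zero.\<close>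

definition sublinear :: "('a::real_vector \<Rightarrow> real) \<Rightarrow> bool" where
  "sublinear p \<longleftrightarrow> (\<forall>x y. p (x + y) \<le> p x + p y) \<and> (\<forall>t>0. \<forall>x. p (t *\<^sub>R x) \<le> t * p x)"

lemma sublinear_add: "sublinear p \<Longrightarrow> p (x + y) \<le> p x + p y"
  by (simp add: sublinear_def)

lemma sublinear_zero:
  assumes "sublinear p" shows "p 0 = 0"
proof -
  have "p 0 \<le> 2 * p 0" "p 0 \<le> (1/2) * p 0"
    using assms unfolding sublinear_def
    by (metis scaleR_zero_right zero_less_numeral, metis scaleR_zero_right half_gt_zero_iff zero_less_one)
  then show ?thesis by simp
qed

lemma sublinear_scaleR:
  assumes "sublinear p" "0 \<le> t" shows "p (t *\<^sub>R x) = t * p x"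
proof (cases "t = 0")
  case True
  then show ?thesis using sublinear_zero[OF assms(1)] by simp
next
  case False
  then have t: "t > 0" using assms by simp
  have 1: "p (t *\<^sub>R x) \<le> t * p x" using assms t by (simp add: sublinear_def)
  have "p (inverse t *\<^sub>R (t *\<^sub>R x)) \<le> inverse t * p (t *\<^sub>R x)"
    using assms t unfolding sublinear_def by (meson inverse_positive_iff_positive)
  then have "p x \<le> inverse t * p (t *\<^sub>R x)" using t by simp
  then have "t * p x \<le> p (t *\<^sub>R x)" using t by (simp add: field_simps)
  with 1 show ?thesis by simp
qed

lemma sublinear_ge_neg:
  assumes "sublinear p" shows "- p (- x) \<le> p x"
  using sublinear_add[OF assms, of x "- x"] sublinear_zero[OF assms] by simp

text \<open>Lowering \<open>p\<close> in the direction \<open>y\<close>; minimal sublinear functionals are fixed by this, which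
  forces them to be additive.\<close>
definition sublinear_shift :: "('a::real_vector \<Rightarrow> real) \<Rightarrow> 'a \<Rightarrow> 'a \<Rightarrow> real" where
  "sublinear_shift p y x = (INF t\<in>{0..}. p (x + t *\<^sub>R y) - t * p y)"

lemma sublinear_shift_le:
  assumes "sublinear p" "0 \<le> t"
  shows "sublinear_shift p y x \<le> p (x + t *\<^sub>R y) - t * p y"
proof -
  \<comment> \<open>Subadditivity supplies a lower bound independent of \<open>t\<close>, so the
    real infimum is genuine.\<close>
  have "- p (- x) \<le> p (x + t *\<^sub>R y) - t * p y" if "0 \<le> t" for t
    using sublinear_add[OF assms(1), of "x + t *\<^sub>R y" "- x"] sublinear_scaleR[OF assms(1) that, of y]
    by simp
  then have "bdd_below ((\<lambda>t. p (x + t *\<^sub>R y) - t * p y) ` {0..})"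
    by (intro bdd_belowI2[where m = "- p (- x)"]) auto
  then show ?thesis
    unfolding sublinear_shift_def using assms(2) by (intro cINF_lower) auto
qed

lemma sublinear_shift_greatest:
  "(\<And>t. 0 \<le> t \<Longrightarrow> m \<le> p (x + t *\<^sub>R y) - t * p y) \<Longrightarrow> m \<le> sublinear_shift p y x"
  unfolding sublinear_shift_def by (rule cINF_greatest) auto

lemma sublinear_sublinear_shift:
  assumes p: "sublinear p" shows "sublinear (sublinear_shift p y)"
  unfolding sublinear_def
proof (intro conjI allI impI)
  fix x x'
  let ?q = "sublinear_shift p y"
  \<comment> \<open>The two infima are resolved one after the other: for fixed \<open>s\<close> and
    \<open>t\<close>, the parameter \<open>s + t\<close> is admissible on the left.\<close>
  have *: "?q (x + x') \<le> (p (x + s *\<^sub>R y) - s * p y) + (p (x' + t *\<^sub>R y) - t * p y)"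
    if "0 \<le> s" "0 \<le> t" for s t
  proof -
    have "p (x + x' + (s + t) *\<^sub>R y) \<le> p (x + s *\<^sub>R y) + p (x' + t *\<^sub>R y)"
      using sublinear_add[OF p, of "x + s *\<^sub>R y" "x' + t *\<^sub>R y"] by (simp add: algebra_simps)
    then show ?thesis
      using sublinear_shift_le[OF p, of "s + t" y "x + x'"] that by (simp add: algebra_simps)
  qed
  have "?q (x + x') - (p (x + s *\<^sub>R y) - s * p y) \<le> ?q x'" if "0 \<le> s" for s
    by (rule sublinear_shift_greatest) (use *[OF that] in \<open>simp add: algebra_simps\<close>)
  then have "?q (x + x') - ?q x' \<le> ?q x"
    by (intro sublinear_shift_greatest) (simp add: algebra_simps)
  then show "?q (x + x') \<le> ?q x + ?q x'" by simp
next
  fix l :: real and x assume l: "0 < l"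
  let ?q = "sublinear_shift p y"
  have "?q (l *\<^sub>R x) / l \<le> ?q x"
  proof (rule sublinear_shift_greatest)
    fix t :: real assume t: "0 \<le> t"
    have "?q (l *\<^sub>R x) \<le> p (l *\<^sub>R x + (l * t) *\<^sub>R y) - (l * t) * p y"
      using l t by (intro sublinear_shift_le[OF p]) simp
    also have "l *\<^sub>R x + (l * t) *\<^sub>R y = l *\<^sub>R (x + t *\<^sub>R y)" by (simp add: algebra_simps)
    also have "p (l *\<^sub>R (x + t *\<^sub>R y)) = l * p (x + t *\<^sub>R y)" using l by (simp add: sublinear_scaleR[OF p])
    finally show "?q (l *\<^sub>R x) / l \<le> p (x + t *\<^sub>R y) - t * p y" using l by (simp add: field_simps)
  qed
  then show "?q (l *\<^sub>R x) \<le> l * ?q x" using l by (simp add: field_simps)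
qed

text \<open>Zorn's lemma for the reversed order. A nonempty chain has its pointwise infimum as lower
  bound, finite because every sublinear \<open>q \<le> p\<close> satisfies
  \<open>- p (- x) \<le> q x\<close>.\<close>

lemma minimal_sublinear_exists:
  assumes p: "sublinear p"
  obtains q where "sublinear q" "q \<le> p" "\<And>r. sublinear r \<Longrightarrow> r \<le> q \<Longrightarrow> r = q"
proof -
  define A where "A = {q. sublinear q \<and> q \<le> p}"
  have "\<exists>m\<in>A. \<forall>a\<in>A. a \<le> m \<longrightarrow> a = m"
  proof (rule predicate_Zorn)
    show "partial_order_on A (relation_of (\<lambda>m a. a \<le> m) A)"
      by (rule partial_order_on_relation_ofI) auto
  next
    fix Q assume Q: "Q \<in> Chains (relation_of (\<lambda>m a. a \<le> m) A)"
    then have QA: "q \<in> A" if "q \<in> Q" for q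
      using that by (auto simp: Chains_def relation_of_def)
    have Qc: "q \<le> r \<or> r \<le> q" if "q \<in> Q" "r \<in> Q" for q r
      using that Q by (auto simp: Chains_def relation_of_def)
    show "\<exists>u\<in>A. \<forall>a\<in>Q. u \<le> a"
    proof (cases "Q = {}")
      case True then show ?thesis using p by (auto simp: A_def)
    next
      case False
      define r where "r x = (INF q\<in>Q. q x)" for x
      have "- p (- x) \<le> q x" if "q \<in> Q" for q x
        using QA[OF that] sublinear_ge_neg[of q x] unfolding A_def le_fun_def
        by (smt (verit) mem_Collect_eq)
      then have "bdd_below ((\<lambda>q. q x) ` Q)" for x
        by (intro bdd_belowI2[where m = "- p (- x)"])
      then have low: "r x \<le> q x" if "q \<in> Q" for q x
        unfolding r_def using that by (intro cINF_lower) auto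
      have great: "m \<le> r x" if "\<And>q. q \<in> Q \<Longrightarrow> m \<le> q x" for m x
        unfolding r_def using that False by (intro cINF_greatest) auto
      have "sublinear r"
        unfolding sublinear_def
      proof (intro conjI allI impI)
        fix x y
        \<comment> \<open>Comparability gives a chain member below both \<open>q\<close> and
          \<open>q'\<close>, whose own subadditivity suffices.\<close>
        have *: "r (x + y) \<le> q x + q' y" if q: "q \<in> Q" "q' \<in> Q" for q q'
        proof -
          obtain s where s: "s \<in> Q" "s \<le> q" "s \<le> q'" using Qc[OF q] q by auto
          have "r (x + y) \<le> s (x + y)" by (rule low[OF s(1)])
          also have "\<dots> \<le> s x + s y" using QA[OF s(1)] by (simp add: A_def sublinear_add)
          also have "\<dots> \<le> q x + q' y" using s by (simp add: le_fun_def add_mono)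
          finally show ?thesis .
        qed
        have "r (x + y) - q x \<le> r y" if "q \<in> Q" for q
          by (rule great) (use *[OF that] in \<open>simp add: algebra_simps\<close>)
        then have "r (x + y) - r y \<le> r x"
          by (intro great) (simp add: algebra_simps)
        then show "r (x + y) \<le> r x + r y" by simp
      next
        fix t :: real and x assume t: "0 < t"
        have "r (t *\<^sub>R x) / t \<le> r x"
        proof (rule great)
          fix q assume q: "q \<in> Q"
          have "r (t *\<^sub>R x) \<le> q (t *\<^sub>R x)" by (rule low[OF q])
          also have "\<dots> = t * q x" using QA[OF q] t by (simp add: A_def sublinear_scaleR)
          finally show "r (t *\<^sub>R x) / t \<le> q x" using t by (simp add: field_simps)
        qed
        then show "r (t *\<^sub>R x) \<le> t * r x" using t by (simp add: field_simps)
      qed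
      moreover have "r \<le> q" if "q \<in> Q" for q
        using low[OF that] by (simp add: le_fun_def)
      moreover obtain q where "q \<in> Q" using False by auto
      ultimately show ?thesis using QA[of q] by (auto simp: A_def intro: order_trans)
    qed
  qed
  then obtain q where q: "q \<in> A" "\<And>a. a \<in> A \<Longrightarrow> a \<le> q \<Longrightarrow> a = q" by blast
  show ?thesis
    by (rule that[of q]) (use q in \<open>auto simp: A_def intro: order_trans\<close>)
qed

text \<open>A minimal \<open>q\<close> equals all its shifts; the parameter 1 then yields
  \<open>q x \<le> q (x + y) - q y\<close>, the reverse of subadditivity.\<close>

lemma linear_below_sublinear:
  assumes p: "sublinear p"
  obtains f where "linear f" "\<And>x. f x \<le> p x"
proof -
  obtain q where q: "sublinear q" "q \<le> p" and min: "\<And>r. sublinear r \<Longrightarrow> r \<le> q \<Longrightarrow> r = q"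
    using minimal_sublinear_exists[OF p] by blast
  have sh: "sublinear_shift q y = q" for y
  proof (rule min[OF sublinear_sublinear_shift[OF q(1)]])
    show "sublinear_shift q y \<le> q"
      using sublinear_shift_le[OF q(1), of 0 y] by (simp add: le_fun_def)
  qed
  have add: "q (x + y) = q x + q y" for x y
    using sublinear_shift_le[OF q(1), of 1 y x] sublinear_add[OF q(1), of x y] by (simp add: sh)
  have neg: "q (- x) = - q x" for x
    using add[of x "- x"] sublinear_zero[OF q(1)] by simp
  have "q (t *\<^sub>R x) = t *\<^sub>R q x" for t x
  proof (cases "0 \<le> t")
    case True then show ?thesis by (simp add: sublinear_scaleR[OF q(1)])
  next
    case False
    then have "q ((- t) *\<^sub>R x) = (- t) * q x" by (intro sublinear_scaleR[OF q(1)]) simp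
    then show ?thesis using neg[of "t *\<^sub>R x"] by simp
  qed
  then have "linear q" using add by (intro linearI)
  then show ?thesis using that q(2) by (auto simp: le_fun_def)
qed

text \<open>A linear functional below the shift of \<open>p\<close> in direction \<open>a\<close>
  works: parameter 0 gives \<open>f \<le> p\<close>, and parameter 1 at \<open>- a\<close> gives
  \<open>f (- a) \<le> - p a\<close>.\<close>

lemma Hahn_Banach_at_point:
  assumes p: "sublinear p"
  obtains f where "linear f" "\<And>x. f x \<le> p x" "f a = p a"
proof -
  obtain f where f: "linear f" "\<And>x. f x \<le> sublinear_shift p a x"
    using linear_below_sublinear[OF sublinear_sublinear_shift[OF p]] by blast
  have le: "f x \<le> p x" for x
    using f(2)[of x] sublinear_shift_le[OF p, of 0 a x] by simp
  have "f (- a) \<le> - p a"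
    using f(2)[of "- a"] sublinear_shift_le[OF p, of 1 a "- a"] sublinear_zero[OF p] by simp
  then have "p a \<le> f a" using linear_neg[OF f(1), of a] by simp
  then show ?thesis using that[OF f(1) le] le[of a] by simp
qed

section \<open>Minkowski gauge and separation of convex sets\<close>

definition gauge_fun :: "'a::real_vector set \<Rightarrow> 'a \<Rightarrow> real" where
  "gauge_fun K x = Inf {s. 0 < s \<and> (1 / s) *\<^sub>R x \<in> K}"

lemma gauge_fun_le:
  assumes "0 < s" "(1 / s) *\<^sub>R x \<in> K" shows "gauge_fun K x \<le> s"
  unfolding gauge_fun_def using assms by (intro cInf_lower) (auto intro!: bdd_belowI[where m = 0])

text \<open>The absorbing hypothesis makes the set of admissible \<open>s\<close> nonempty, as a
  lower bound for a real infimum requires.\<close>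

lemma gauge_fun_greatest:
  assumes "\<And>d. \<exists>\<delta>>0. \<delta> *\<^sub>R d \<in> K"
    and "\<And>s. 0 < s \<Longrightarrow> (1 / s) *\<^sub>R x \<in> K \<Longrightarrow> m \<le> s"
  shows "m \<le> gauge_fun K x"
  unfolding gauge_fun_def
proof (rule cInf_greatest)
  obtain \<delta> where "\<delta> > 0" "\<delta> *\<^sub>R x \<in> K" using assms(1) by blast
  then have "1 / \<delta> \<in> {s. 0 < s \<and> (1 / s) *\<^sub>R x \<in> K}" by simp
  then show "{s. 0 < s \<and> (1 / s) *\<^sub>R x \<in> K} \<noteq> {}" by blast
qed (use assms(2) in auto)

text \<open>Subadditivity holds because \<open>(x + y) / (s + t)\<close> is the convex combination
  of \<open>x / s\<close> and \<open>y / t\<close> with weights \<open>s / (s + t)\<close> and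
  \<open>t / (s + t)\<close>.\<close>

lemma sublinear_gauge_fun:
  assumes K: "convex K" and ab: "\<And>d. \<exists>\<delta>>0. \<delta> *\<^sub>R d \<in> K"
  shows "sublinear (gauge_fun K)"
  unfolding sublinear_def
proof (intro conjI allI impI)
  fix x y
  let ?g = "gauge_fun K"
  have *: "?g (x + y) \<le> s + t"
    if s: "0 < s" "(1 / s) *\<^sub>R x \<in> K" and t: "0 < t" "(1 / t) *\<^sub>R y \<in> K" for s t
  proof (rule gauge_fun_le)
    have "(s / (s + t)) *\<^sub>R ((1 / s) *\<^sub>R x) + (t / (s + t)) *\<^sub>R ((1 / t) *\<^sub>R y) \<in> K"
      using s t by (intro convexD[OF K]) (auto simp: add_divide_distrib[symmetric])
    then show "(1 / (s + t)) *\<^sub>R (x + y) \<in> K"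
      using s t by (simp add: scaleR_add_right)
  qed (use s t in simp)
  have "?g (x + y) - s \<le> ?g y" if "0 < s" "(1 / s) *\<^sub>R x \<in> K" for s
    by (rule gauge_fun_greatest[OF ab]) (use *[OF that] in \<open>simp add: algebra_simps\<close>)
  then have "?g (x + y) - ?g y \<le> ?g x"
    by (intro gauge_fun_greatest[OF ab]) (simp add: algebra_simps)
  then show "?g (x + y) \<le> ?g x + ?g y" by simp
next
  fix l :: real and x assume l: "0 < l"
  have "gauge_fun K (l *\<^sub>R x) / l \<le> gauge_fun K x"
  proof (rule gauge_fun_greatest[OF ab])
    fix s :: real assume s: "0 < s" "(1 / s) *\<^sub>R x \<in> K"
    have "gauge_fun K (l *\<^sub>R x) \<le> l * s" using s l by (intro gauge_fun_le) auto
    then show "gauge_fun K (l *\<^sub>R x) / l \<le> s" using l by (simp add: field_simps)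
  qed
  then show "gauge_fun K (l *\<^sub>R x) \<le> l * gauge_fun K x" using l by (simp add: field_simps)
qed

text \<open>If some \<open>s < 1\<close> were admissible, \<open>x\<close> would be a convex
  combination of \<open>x / s\<close> and 0, both in \<open>K\<close>.\<close>

lemma gauge_fun_ge_one:
  assumes K: "convex K" and ab: "\<And>d. \<exists>\<delta>>0. \<delta> *\<^sub>R d \<in> K" and x: "x \<notin> K"
  shows "1 \<le> gauge_fun K x"
proof (rule gauge_fun_greatest[OF ab])
  fix s :: real assume s: "0 < s" "(1 / s) *\<^sub>R x \<in> K"
  have 0: "0 \<in> K" using ab[of 0] by auto
  show "1 \<le> s"
  proof (rule ccontr)
    assume "\<not> 1 \<le> s"
    then have "s *\<^sub>R ((1 / s) *\<^sub>R x) + (1 - s) *\<^sub>R 0 \<in> K"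
      using s 0 by (intro convexD[OF K]) auto
    then show False using s x by simp
  qed
qed

text \<open>Hahn-Banach is applied to the gauge of \<open>K = (a0 - n0) + (N - A)\<close>. This set
  is absorbing because \<open>N\<close> is absorbing at \<open>n0\<close>, and it misses
  \<open>a0 - n0\<close> because \<open>N\<close> and \<open>A\<close> are disjoint. So
  \<open>f\<close> is at most 1 on \<open>K\<close> and at least 1 at
  \<open>a0 - n0\<close>.\<close>

lemma convex_separation:
  fixes N A :: "'a::real_vector set"
  assumes N: "convex N" and A: "convex A" and disj: "N \<inter> A = {}" and a0: "a0 \<in> A"
    and ab: "\<And>d. \<exists>\<delta>>0. n0 + \<delta> *\<^sub>R d \<in> N"
  obtains f where "linear f" "\<And>n a. n \<in> N \<Longrightarrow> a \<in> A \<Longrightarrow> f n \<le> (f a :: real)" "f n0 < f a0"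
proof -
  have n0: "n0 \<in> N" using ab[of 0] by auto
  define K where "K = (\<lambda>x. (a0 - n0) + x) ` {n - a |n a. n \<in> N \<and> a \<in> A}"
  have "{n - a |n a. n \<in> N \<and> a \<in> A} = (\<Union>n\<in>N. \<Union>a\<in>A. {n - a})" by blast
  then have K: "convex K"
    unfolding K_def using convex_differences[OF N A] by (intro convex_translation) simp
  have KI: "n - a + (a0 - n0) \<in> K" if "n \<in> N" "a \<in> A" for n a
  proof -
    have "n - a \<in> {n - a |n a. n \<in> N \<and> a \<in> A}" using that by blast
    then have "(a0 - n0) + (n - a) \<in> K" unfolding K_def by (rule imageI)
    then show ?thesis by (simp only: add.commute)
  qed
  have abK: "\<exists>\<delta>>0. \<delta> *\<^sub>R d \<in> K" for d
    using ab[of d] KI[OF _ a0] by fastforce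
  have "a0 - n0 \<notin> K"
  proof
    assume "a0 - n0 \<in> K"
    then obtain n a where "n \<in> N" "a \<in> A" "n - a = 0" unfolding K_def by auto
    then show False using disj by auto
  qed
  then have one: "1 \<le> gauge_fun K (a0 - n0)" by (rule gauge_fun_ge_one[OF K abK])
  obtain f where f: "linear f" "\<And>x. f x \<le> gauge_fun K x" "f (a0 - n0) = gauge_fun K (a0 - n0)"
    using Hahn_Banach_at_point[OF sublinear_gauge_fun[OF K abK]] by blast
  have ge: "1 \<le> f a0 - f n0" using one f(3) linear_diff[OF f(1)] by simp
  show ?thesis
  proof (rule that[OF f(1)])
    fix n a assume na: "n \<in> N" "a \<in> A"
    have "f (n - a + (a0 - n0)) \<le> 1"
      using f(2) gauge_fun_le[of 1 _ K] KI[OF na] by (metis divide_self_if order_trans scaleR_one zero_less_one zero_neq_one)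
    then have "f n - f a + (f a0 - f n0) \<le> 1"
      using linear_add[OF f(1)] linear_diff[OF f(1)] by simp
    then show "f n \<le> f a" using ge by linarith
  qed (use ge in simp)
qed


section \<open>Locally convex spaces and their duals\<close>

lemma lcs_continuous_affine:
  assumes "lcs tau"
  shows "continuous_map tau tau (\<lambda>y. b + r *\<^sub>R y)"
    and "continuous_map euclideanreal tau (\<lambda>t. b + t *\<^sub>R d)"
proof -
  have top: "topspace tau = UNIV"
    and add: "continuous_map (prod_topology tau tau) tau (\<lambda>(x,y). x + y)"
    and sc: "continuous_map (prod_topology euclideanreal tau) tau (\<lambda>(a,x). a *\<^sub>R x)"
    using assms by (auto simp: lcs_def)
  have plus: "continuous_map W tau (\<lambda>w. b + g w)" if "continuous_map W tau g" for W and g :: "'c \<Rightarrow> 'a"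
    using continuous_map_compose[OF continuous_map_pairedI[OF continuous_map_const[THEN iffD2] that] add, of b] top
    by (auto simp: o_def)
  have times: "continuous_map W tau (\<lambda>w. f w *\<^sub>R g w)"
    if "continuous_map W euclideanreal f" "continuous_map W tau g" for W f and g :: "'c \<Rightarrow> 'a"
    using continuous_map_compose[OF continuous_map_pairedI[OF that] sc] by (simp add: o_def)
  show "continuous_map tau tau (\<lambda>y. b + r *\<^sub>R y)"
    by (intro plus times) (auto simp: top)
  show "continuous_map euclideanreal tau (\<lambda>t. b + t *\<^sub>R d)"
    by (intro plus times) (auto simp: top)
qed

text \<open>The preimage of \<open>U\<close> under the continuous map \<open>t\<close> to
  \<open>x + t d\<close> is an open set of reals containing 0.\<close>

lemma lcs_open_absorbing:
  assumes "lcs tau" "openin tau U" "x \<in> U"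
  shows "\<exists>\<delta>>0. \<forall>t. \<bar>t\<bar> \<le> \<delta> \<longrightarrow> x + t *\<^sub>R d \<in> U"
proof -
  have "openin euclideanreal {t \<in> topspace euclideanreal. x + t *\<^sub>R d \<in> U}"
    by (rule openin_continuous_map_preimage[OF lcs_continuous_affine(2)[OF assms(1)] assms(2)])
  then have "open {t. x + t *\<^sub>R d \<in> U}" by simp
  then obtain e where e: "e > 0" "cball 0 e \<subseteq> {t. x + t *\<^sub>R d \<in> U}"
    using assms(3) by (metis (mono_tags, lifting) add.right_neutral mem_Collect_eq open_contains_cball scaleR_zero_left)
  then show ?thesis by (intro exI[of _ e]) (auto simp: subset_iff)
qed

text \<open>A one-sided bound suffices: for \<open>y\<close> near \<open>x\<close>, both
  \<open>x0 + s (y - x)\<close> and \<open>x0 - s (y - x)\<close> lie in \<open>U\<close>, which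
  bounds the difference of \<open>f y\<close> and \<open>f x\<close> from both sides.\<close>

lemma dualI_bounded_above:
  assumes lcs: "lcs tau" and f: "linear f" and U: "openin tau U" "x0 \<in> U"
    and bd: "\<And>x. x \<in> U \<Longrightarrow> f x \<le> M"
  shows "f \<in> dual tau"
proof -
  have top: "topspace tau = UNIV" using lcs by (simp add: lcs_def)
  have M: "0 \<le> M - f x0" using bd[OF U(2)] by simp
  have "\<exists>W. openin tau W \<and> x \<in> W \<and> (\<forall>y\<in>W. f y \<in> V)" if V: "open V" "f x \<in> V" for x V
  proof -
    obtain e where e: "e > 0" "ball (f x) e \<subseteq> V" using V open_contains_ball by blast
    \<comment> \<open>Chosen so that \<open>M - f x0 < s * e\<close>; the added 1 keeps
      \<open>s\<close> positive when \<open>M = f x0\<close>.\<close>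
    define s where "s = (M - f x0 + 1) / e"
    have s: "s > 0" using e M by (simp add: s_def)
    define g where "g r y = (x0 - r *\<^sub>R x) + r *\<^sub>R y" for r y
    define W where "W = {y \<in> topspace tau. g s y \<in> U} \<inter> {y \<in> topspace tau. g (- s) y \<in> U}"
    have "openin tau W"
      unfolding W_def g_def
      by (intro openin_Int openin_continuous_map_preimage[OF lcs_continuous_affine(1)[OF lcs] U(1)])
    moreover have "x \<in> W" using U(2) by (simp add: W_def top g_def)
    moreover have "f y \<in> V" if y: "y \<in> W" for y
    proof -
      have fg: "f (g r y) = f x0 + r * (f y - f x)" for r
        unfolding g_def by (simp add: linear_add[OF f] linear_diff[OF f] linear_cmul[OF f] algebra_simps)
      have "g s y \<in> U" "g (- s) y \<in> U" using y by (auto simp: W_def)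
      then have "f x0 + s * (f y - f x) \<le> M" "f x0 + (- s) * (f y - f x) \<le> M"
        using bd[of "g s y"] bd[of "g (- s) y"] by (simp_all only: fg)
      then have "s * \<bar>f y - f x\<bar> \<le> M - f x0"
        using s by (auto simp: abs_if algebra_simps)
      also have "\<dots> < s * e" using e by (simp add: s_def)
      finally have "\<bar>f y - f x\<bar> < e" using s by simp
      then show ?thesis using e(2) by (auto simp: dist_real_def subset_iff abs_minus_commute)
    qed
    ultimately show ?thesis by blast
  qed
  then have "openin tau {x. f x \<in> V}" if "open V" for V
    unfolding openin_subopen[of tau "{x. f x \<in> V}"]
    using that by (simp add: subset_iff Ball_def)
  then have "continuous_map tau euclideanreal f"
    by (simp add: continuous_map_def top)
  then show ?thesis using f by (simp add: dual_def)
qed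

lemma dual_linear: "f \<in> dual tau \<Longrightarrow> linear f"
  by (simp add: dual_def)

lemma dual_combination:
  assumes "f \<in> dual tau" "g \<in> dual tau"
  shows "(\<lambda>y. s * f y + t * g y) \<in> dual tau"
proof -
  have "linear (\<lambda>y. s * f y + t * g y)"
    using assms[THEN dual_linear]
    by (intro linearI) (simp_all add: linear_add[of f] linear_add[of g] linear_cmul[of f] linear_cmul[of g] algebra_simps)
  moreover have "continuous_map tau euclideanreal (\<lambda>y. s * f y + t * g y)"
    using assms unfolding dual_def
    by (intro continuous_map_add[of tau "\<lambda>y. s * f y" "\<lambda>y. t * g y"] continuous_map_real_mult_left) blast+
  ultimately show ?thesis by (simp add: dual_def)
qed

lemma Ztop_closed_avoiding_box:
  assumes lcs: "lcs tau" and S: "closedin (Ztop tau) S" and a: "\<alpha> \<in> dual tau" "(a, \<alpha>) \<notin> S"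
  obtains U I \<epsilon> where "openin tau U" "convex U" "a \<in> U" "finite I" "\<epsilon> > 0"
    "\<And>v k. v \<in> U \<Longrightarrow> k \<in> dual tau \<Longrightarrow> (\<And>e. e \<in> I \<Longrightarrow> \<bar>k e - \<alpha> e\<bar> < \<epsilon>) \<Longrightarrow> (v, k) \<notin> S"
proof -
  have top: "topspace tau = UNIV" using lcs by (simp add: lcs_def)
  have tW: "topspace (weak_star tau) = dual tau" by (simp add: weak_star_def)
  have "openin (Ztop tau) (topspace (Ztop tau) - S)" using S by auto
  moreover have "(a, \<alpha>) \<in> topspace (Ztop tau) - S" using a by (simp add: Ztop_def tW top)
  ultimately have "\<exists>U V. openin tau U \<and> openin (weak_star tau) V \<and> a \<in> U \<and> \<alpha> \<in> V
      \<and> U \<times> V \<subseteq> topspace (Ztop tau) - S"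
    by (rule openin_prod_topology_alt[of tau "weak_star tau", folded Ztop_def, THEN iffD1, rule_format])
  then obtain U0 V where UV: "openin tau U0" "openin (weak_star tau) V" "a \<in> U0" "\<alpha> \<in> V"
      "U0 \<times> V \<subseteq> topspace (Ztop tau) - S"
    by (elim exE conjE)
  obtain U where U: "openin tau U" "convex U" "a \<in> U" "U \<subseteq> U0"
    using lcs UV(1,3) unfolding lcs_def by meson
  obtain V' where V': "openin (product_topology (\<lambda>_. euclideanreal) UNIV) V'" "V = V' \<inter> dual tau"
    using UV(2) unfolding weak_star_def openin_subtopology by blast
  obtain B where B: "finite {i. B i \<noteq> UNIV}" "\<And>i. open (B i)" "\<alpha> \<in> Pi\<^sub>E UNIV B" "Pi\<^sub>E UNIV B \<subseteq> V'"
    using V'(1) UV(4) unfolding V'(2) openin_product_topology_alt by force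
  define I where "I = {i. B i \<noteq> UNIV}"
  have "\<exists>\<epsilon>>0. ball (\<alpha> i) \<epsilon> \<subseteq> B i" for i
    using B(2,3) by (meson PiE_mem UNIV_I open_contains_ball)
  then obtain \<epsilon>' where \<epsilon>': "\<And>i. \<epsilon>' i > 0" "\<And>i. ball (\<alpha> i) (\<epsilon>' i) \<subseteq> B i" by metis
  \<comment> \<open>Inserting 1 keeps the minimum defined when \<open>I\<close> is empty.\<close>
  define \<epsilon> where "\<epsilon> = Min (insert 1 (\<epsilon>' ` I))"
  have fin: "finite I" using B(1) by (simp add: I_def)
  have pos: "\<epsilon> > 0" using fin \<epsilon>'(1) by (auto simp: \<epsilon>_def)
  have le: "\<epsilon> \<le> \<epsilon>' i" if "i \<in> I" for i using fin that by (auto simp: \<epsilon>_def)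
  show ?thesis
  proof (rule that[OF U(1-3) fin pos])
    fix v k assume v: "v \<in> U" and k: "k \<in> dual tau" and c: "\<And>e. e \<in> I \<Longrightarrow> \<bar>k e - \<alpha> e\<bar> < \<epsilon>"
    have "k i \<in> B i" for i
    proof (cases "i \<in> I")
      case True
      then have "k i \<in> ball (\<alpha> i) (\<epsilon>' i)"
        using c[OF True] le[OF True] by (simp add: dist_real_def abs_minus_commute)
      then show ?thesis using \<epsilon>'(2) by blast
    qed (simp add: I_def)
    then have "k \<in> V" using B(4) k unfolding V'(2) by auto
    then show "(v, k) \<notin> S" using UV(5) U(4) v by blast
  qed
qed

section \<open>Fenchel--Moreau duality for the pairing of \<open>Z\<close> with itself\<close>

text \<open>Separation is carried out in \<open>X \<times> \<real>\<^sup>X \<times> \<real>\<close>, with all functions in place of the dual: there unit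
  vectors are available, which makes a functional that is bounded on a weak-star box a finite
  combination of evaluations, hence evaluation at a point on linear functions.\<close>

instantiation "fun" :: (type, real_vector) real_vector
begin

definition scaleR_fun :: "real \<Rightarrow> ('a \<Rightarrow> 'b) \<Rightarrow> 'a \<Rightarrow> 'b" where
  "scaleR_fun r f = (\<lambda>x. r *\<^sub>R f x)"

instance
  by standard (auto simp: scaleR_fun_def fun_eq_iff algebra_simps)

end

lemma scaleR_fun_apply [simp]: "(r *\<^sub>R f) x = r *\<^sub>R f x"
  by (simp add: scaleR_fun_def)

text \<open>\<open>G\<close> sees only the coordinates in \<open>I\<close>, so \<open>G k\<close> is
  the sum of \<open>k e * G (\<delta> e)\<close> over \<open>I\<close>. For linear \<open>k\<close>
  this is \<open>k\<close> evaluated at the point \<open>u\<close> with coefficients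
  \<open>G (\<delta> e)\<close>.\<close>

lemma linear_fun_finite_support:
  fixes G :: "('a::real_vector \<Rightarrow> real) \<Rightarrow> real"
  assumes G: "linear G" and I: "finite I" and van: "\<And>k. (\<And>e. e \<in> I \<Longrightarrow> k e = 0) \<Longrightarrow> G k = 0"
  obtains u where "\<And>k. linear k \<Longrightarrow> G k = k u"
proof -
  define \<delta> :: "'a \<Rightarrow> 'a \<Rightarrow> real" where "\<delta> e = (\<lambda>x. if x = e then 1 else 0)" for e
  define u where "u = (\<Sum>e\<in>I. G (\<delta> e) *\<^sub>R e)"
  have "G k = k u" if k: "linear k" for k
  proof -
    let ?s = "\<Sum>e\<in>I. k e *\<^sub>R \<delta> e"
    have ap: "(\<Sum>e\<in>J. k e *\<^sub>R \<delta> e) x = (\<Sum>e\<in>J. k e * \<delta> e x)" if "finite J" for x J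
      using that by induction auto
    have "G (k - ?s) = 0"
    proof (rule van)
      fix e assume e: "e \<in> I"
      have "?s e = (\<Sum>i\<in>I. k i * \<delta> i e)" by (rule ap[OF I])
      also have "\<dots> = (\<Sum>i\<in>I. if i = e then k e else 0)" by (rule sum.cong) (auto simp: \<delta>_def)
      also have "\<dots> = k e" using I e by simp
      finally show "(k - ?s) e = 0" by simp
    qed
    then have "G k = G ?s" by (simp add: linear_diff[OF G])
    also have "\<dots> = (\<Sum>e\<in>I. k e * G (\<delta> e))" by (simp add: linear_sum[OF G] linear_cmul[OF G])
    also have "\<dots> = k u" by (simp add: u_def linear_sum[OF k] linear_cmul[OF k] mult.commute)
    finally show ?thesis .
  qed
  then show ?thesis using that by blast
qed

text \<open>\<open>affine_minorant tau h u g \<beta>\<close> says that \<open>((u, g), \<beta>)\<close> lies in the epigraph of the conjugate of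
  \<open>h\<close> for the pairing \<open>\<langle>(x, k), (u, g)\<rangle> = k u + g x\<close>.\<close>
definition affine_minorant ::
  "'a::real_vector topology \<Rightarrow> ('a \<times> ('a \<Rightarrow> real) \<Rightarrow> ereal) \<Rightarrow> 'a \<Rightarrow> ('a \<Rightarrow> real) \<Rightarrow> real \<Rightarrow> bool" where
  "affine_minorant tau h u g \<beta> \<longleftrightarrow>
     g \<in> dual tau \<and> (\<forall>x k. k \<in> dual tau \<longrightarrow> ereal (k u + g x - \<beta>) \<le> h (x, k))"

section \<open>Epigraphs and boxes: convexity and absorption\<close>

lemma convex_epigraph:
  assumes "convex_fun tau h"
  shows "convex {(v, k, s). k \<in> dual tau \<and> h (v, k) \<le> ereal s}"
  unfolding convex_alt
proof (intro ballI allI impI, elim conjE)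
  fix p q and t :: real
  assume p: "p \<in> {(v, k, s). k \<in> dual tau \<and> h (v, k) \<le> ereal s}"
    and q: "q \<in> {(v, k, s). k \<in> dual tau \<and> h (v, k) \<le> ereal s}" and t: "0 \<le> t" "t \<le> 1"
  obtain v k s where p': "p = (v, k, s)" "k \<in> dual tau" "h (v, k) \<le> ereal s" using p by auto
  obtain v' k' s' where q': "q = (v', k', s')" "k' \<in> dual tau" "h (v', k') \<le> ereal s'" using q by auto
  consider "t = 0" | "t = 1" | "0 < t" "t < 1" using t by linarith
  then show "(1 - t) *\<^sub>R p + t *\<^sub>R q \<in> {(v, k, s). k \<in> dual tau \<and> h (v, k) \<le> ereal s}"
  proof cases
    case 3
    have k: "t *\<^sub>R k' + (1 - t) *\<^sub>R k = (\<lambda>y. t * k' y + (1 - t) * k y)" by (simp add: fun_eq_iff)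
    have "h (t *\<^sub>R v' + (1 - t) *\<^sub>R v, (\<lambda>y. t * k' y + (1 - t) * k y))
        \<le> ereal t * h (v', k') + ereal (1 - t) * h (v, k)"
      using assms[unfolded convex_fun_def Zspace_def, rule_format, of "(v', k')" "(v, k)" t] p'(2) q'(2) 3
      by simp
    also have "\<dots> \<le> ereal t * ereal s' + ereal (1 - t) * ereal s"
      using 3 p'(3) q'(3) by (intro add_mono ereal_mult_left_mono) auto
    finally have "h (t *\<^sub>R v' + (1 - t) *\<^sub>R v, t *\<^sub>R k' + (1 - t) *\<^sub>R k) \<le> ereal (t * s' + (1 - t) * s)"
      by (simp add: k)
    moreover have "t *\<^sub>R k' + (1 - t) *\<^sub>R k \<in> dual tau"
      using dual_combination[OF q'(2) p'(2)] by (simp add: k)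
    ultimately show ?thesis by (simp add: p'(1) q'(1) add.commute)
  qed (use p q in auto)
qed


lemma convex_weak_star_box: "convex {k :: 'a \<Rightarrow> real. \<forall>e\<in>I. \<bar>k e - \<alpha> e\<bar> < \<epsilon>}"
proof -
  have "{k :: 'a \<Rightarrow> real. \<forall>e\<in>I. \<bar>k e - \<alpha> e\<bar> < \<epsilon>} = (\<Inter>e\<in>I. (\<lambda>k. k e) -` ball (\<alpha> e) \<epsilon>)"
    by (auto simp: dist_real_def abs_minus_commute)
  moreover have "linear (\<lambda>k :: 'a \<Rightarrow> real. k e)" for e
    by (intro linearI) simp_all
  ultimately show ?thesis
    by (simp only:) (intro convex_INT convex_linear_vimage convex_ball)
qed

lemma small_scaling:
  fixes m \<epsilon> :: real
  assumes "0 < \<epsilon>"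
  obtains \<delta> where "0 < \<delta>" "\<And>t. 0 \<le> t \<Longrightarrow> t \<le> \<delta> \<Longrightarrow> t * \<bar>m\<bar> < \<epsilon>"
proof
  show "0 < \<epsilon> / (\<bar>m\<bar> + 1)" using assms by simp
  fix t assume t: "0 \<le> t" "t \<le> \<epsilon> / (\<bar>m\<bar> + 1)"
  then have "t * \<bar>m\<bar> \<le> \<epsilon> / (\<bar>m\<bar> + 1) * \<bar>m\<bar>" by (intro mult_right_mono) auto
  also have "\<dots> < \<epsilon>" using assms by (simp add: field_simps)
  finally show "t * \<bar>m\<bar> < \<epsilon>" .
qed

text \<open>Supplies the absorbing hypothesis of \<open>convex_separation\<close>. Directions may
  contain arbitrary functions, but only the finitely many coordinates in \<open>I\<close> count, and
  the sum \<open>m\<close> controls them together.\<close>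

lemma box_absorbing:
  assumes lcs: "lcs tau" and U: "openin tau U" "a \<in> U" and I: "finite I" and pos: "0 < \<epsilon>" "r < (r'::real)"
  shows "\<exists>\<delta>>0. (a, \<alpha>, r) + \<delta> *\<^sub>R d \<in> U \<times> {k :: 'a \<Rightarrow> real. \<forall>e\<in>I. \<bar>k e - \<alpha> e\<bar> < \<epsilon>} \<times> {..<r'}"
proof -
  obtain d1 d2 d3 where d: "d = (d1, d2, d3)" by (cases d)
  obtain x where x: "x > 0" "\<And>t. \<bar>t\<bar> \<le> x \<Longrightarrow> a + t *\<^sub>R d1 \<in> U"
    using lcs_open_absorbing[OF lcs U] by blast
  define m where "m = (\<Sum>e\<in>I. \<bar>d2 e\<bar>)"
  obtain y where y: "y > 0" "\<And>t. 0 \<le> t \<Longrightarrow> t \<le> y \<Longrightarrow> t * \<bar>m\<bar> < \<epsilon>"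
    using small_scaling[OF pos(1)] by blast
  obtain z where z: "z > 0" "\<And>t. 0 \<le> t \<Longrightarrow> t \<le> z \<Longrightarrow> t * \<bar>d3\<bar> < r' - r"
    using small_scaling[of "r' - r"] pos(2) by (metis diff_gt_0_iff_gt)
  define \<delta> where "\<delta> = min x (min y z)"
  have \<delta>: "\<delta> > 0" "\<delta> \<le> x" "\<delta> \<le> y" "\<delta> \<le> z" using x y z by (auto simp: \<delta>_def)
  have "\<delta> * \<bar>d2 e\<bar> < \<epsilon>" if "e \<in> I" for e
  proof -
    have "\<bar>d2 e\<bar> \<le> \<bar>m\<bar>" using member_le_sum[OF that, of "\<lambda>e. \<bar>d2 e\<bar>"] I by (simp add: m_def)
    then have "\<delta> * \<bar>d2 e\<bar> \<le> \<delta> * \<bar>m\<bar>" using \<delta>(1) by simp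
    also have "\<dots> < \<epsilon>" using y(2) \<delta> by simp
    finally show ?thesis .
  qed
  moreover have "r + \<delta> * d3 < r'"
  proof -
    have "\<delta> * d3 \<le> \<delta> * \<bar>d3\<bar>" using \<delta>(1) by simp
    also have "\<dots> < r' - r" using z(2) \<delta> by simp
    finally show ?thesis by simp
  qed
  moreover have "a + \<delta> *\<^sub>R d1 \<in> U" using x(2)[of \<delta>] \<delta> by simp
  ultimately show ?thesis using \<delta>(1) by (intro exI[of _ \<delta>]) (auto simp: d abs_mult)
qed

text \<open>Lower semicontinuity gives a box around \<open>(a, \<alpha>)\<close> on which
  \<open>h\<close> exceeds some \<open>r' > r\<close>. The box times the half-line below
  \<open>r'\<close> misses the epigraph, and a separating functional splits into a part in the dual,
  a point evaluation and a factor \<open>b\<close>.\<close>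

lemma affine_separation_from_epigraph:
  assumes lcs: "lcs tau" and pr: "proper_fun tau h" and cv: "convex_fun tau h" and lsc: "lsc_fun tau h"
    and \<alpha>: "\<alpha> \<in> dual tau" and lt: "ereal r < h (a, \<alpha>)"
  obtains u f b \<eta> where "f \<in> dual tau" "0 \<le> b" "0 < \<eta>"
    "\<And>v k s. k \<in> dual tau \<Longrightarrow> h (v, k) \<le> ereal s \<Longrightarrow> f a + \<alpha> u + b * r + \<eta> \<le> f v + k u + b * s"
proof -
  obtain r' where r': "r < r'" "ereal r' < h (a, \<alpha>)"
    using ereal_dense2[OF lt] by auto
  define S where "S = {z \<in> Zspace tau. h z \<le> ereal r'}"
  have "closedin (Ztop tau) S" using lsc by (simp add: S_def lsc_fun_def)
  moreover have "(a, \<alpha>) \<notin> S" using r'(2) by (simp add: S_def not_le)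
  ultimately obtain U I \<epsilon> where U: "openin tau U" "convex U" "a \<in> U" and I: "finite I" and \<epsilon>: "\<epsilon> > 0"
    and av: "\<And>v k. v \<in> U \<Longrightarrow> k \<in> dual tau \<Longrightarrow> (\<And>e. e \<in> I \<Longrightarrow> \<bar>k e - \<alpha> e\<bar> < \<epsilon>) \<Longrightarrow> (v, k) \<notin> S"
    using Ztop_closed_avoiding_box[OF lcs _ \<alpha>] by metis
  define N where "N = U \<times> {k :: 'a \<Rightarrow> real. \<forall>e\<in>I. \<bar>k e - \<alpha> e\<bar> < \<epsilon>} \<times> {..<r'}"
  define A where "A = {(v, k, s). k \<in> dual tau \<and> h (v, k) \<le> ereal s}"
  have cN: "convex N" unfolding N_def using U(2) convex_weak_star_box by (intro convex_Times) auto
  have cA: "convex A" unfolding A_def by (rule convex_epigraph[OF cv])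
  have disj: "N \<inter> A = {}"
  proof -
    have False if "(v, k, s) \<in> N" "(v, k, s) \<in> A" for v k s
    proof -
      have "h (v, k) \<le> ereal s" "s < r'" "k \<in> dual tau" using that by (auto simp: N_def A_def)
      then have "(v, k) \<in> S"
        unfolding S_def Zspace_def by (auto intro: order_trans[of _ "ereal s"])
      then show False using av[of v k] that by (auto simp: N_def A_def)
    qed
    then show ?thesis by auto
  qed
  have abs: "\<exists>\<delta>>0. (a, \<alpha>, r) + \<delta> *\<^sub>R d \<in> N" for d
    unfolding N_def by (rule box_absorbing[OF lcs U(1,3) I \<epsilon> r'(1)])
  obtain z where z: "z \<in> Zspace tau" "h z \<noteq> \<infinity>" "h z \<noteq> -\<infinity>" using pr by (auto simp: proper_fun_def)
  then obtain v0 k0 s0 where z0: "k0 \<in> dual tau" "h (v0, k0) = ereal s0"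
    by (cases z; cases "h z") (auto simp: Zspace_def)
  have a0: "(v0, k0, s0) \<in> A" using z0 by (simp add: A_def)
  obtain F where F: "linear F" and FN: "\<And>n p. n \<in> N \<Longrightarrow> p \<in> A \<Longrightarrow> F n \<le> (F p :: real)"
    and Flt: "F (a, \<alpha>, r) < F (v0, k0, s0)"
    using convex_separation[OF cN cA disj a0 abs] by metis
  define f where "f x = F (x, 0, 0)" for x
  define G where "G k = F (0, k, 0)" for k
  define b where "b = F (0, 0, 1)"
  have lf: "linear f" unfolding f_def
    using linear_add[OF F, of "(_, 0, 0)" "(_, 0, 0)"] linear_cmul[OF F, of _ "(_, 0, 0)"]
    by (intro linearI) (simp_all add: scaleR_zero_right)
  have lG: "linear G" unfolding G_def
    using linear_add[OF F, of "(0, _, 0)" "(0, _, 0)"] linear_cmul[OF F, of _ "(0, _, 0)"]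
    by (intro linearI) (simp_all add: scaleR_zero_right)
  have dec: "F (x, k, s) = f x + G k + b * s" for x k s
  proof -
    have "F (x, k, s) = F ((x, 0, 0) + (0, k, 0) + s *\<^sub>R (0, 0, 1))" by simp
    also have "\<dots> = f x + G k + s * b"
      by (simp only: linear_add[OF F] linear_cmul[OF F] f_def G_def b_def real_scaleR_def)
    finally show ?thesis by simp
  qed
  have PN: "(a, \<alpha>, r) \<in> N" using abs[of 0] by simp
  have "f x \<le> F (v0, k0, s0) - G \<alpha> - b * r" if "x \<in> U" for x
  proof -
    have "(x, \<alpha>, r) \<in> N" using that r'(1) \<epsilon> by (simp add: N_def)
    from FN[OF this a0] show ?thesis by (simp add: dec)
  qed
  then have fd: "f \<in> dual tau" by (rule dualI_bounded_above[OF lcs lf U(1,3)])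
  \<comment> \<open>Adding multiples of such a \<open>k\<close> to \<alpha> never leaves
    \<open>N\<close>, on which \<open>F\<close> is bounded by its value at a point of
    \<open>A\<close>.\<close>
  have van: "G k = 0" if k: "\<And>e. e \<in> I \<Longrightarrow> k e = 0" for k
  proof (rule ccontr)
    assume nz: "G k \<noteq> 0"
    define t where "t = (F (v0, k0, s0) - F (a, \<alpha>, r) + 1) / G k"
    have "(a, \<alpha> + t *\<^sub>R k, r) \<in> N" using PN k by (simp add: N_def)
    from FN[OF this a0] have "t * G k \<le> F (v0, k0, s0) - F (a, \<alpha>, r)"
      by (simp add: dec linear_add[OF lG] linear_cmul[OF lG])
    then show False using nz by (simp add: t_def)
  qed
  obtain u where u: "\<And>k. linear k \<Longrightarrow> G k = k u" using linear_fun_finite_support[OF lG I van] by metis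
  \<comment> \<open>The epigraph is closed upwards, so a negative \<open>b\<close> would push
    \<open>F\<close> on \<open>A\<close> below its value at \<open>(a, \<alpha>, r)\<close>;
    \<open>t\<close> overshoots by one.\<close>
  have b0: "0 \<le> b"
  proof (rule ccontr)
    assume neg: "\<not> 0 \<le> b"
    define t where "t = (F (v0, k0, s0) - F (a, \<alpha>, r) + 1) / (- b)"
    have "0 \<le> t" using neg Flt by (simp add: t_def field_simps)
    then have "(v0, k0, s0 + t) \<in> A" using z0 by (simp add: A_def)
    from FN[OF PN this] have "F (a, \<alpha>, r) \<le> F (v0, k0, s0) + b * t" by (simp add: dec algebra_simps)
    moreover have "b * t = - (F (v0, k0, s0) - F (a, \<alpha>, r) + 1)" using neg by (simp add: t_def field_simps)
    ultimately show False by simp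
  qed
  \<comment> \<open>A short move from \<open>(a, \<alpha>, r)\<close> towards the epigraph stays in
    \<open>N\<close> and raises \<open>F\<close> by \<eta>, turning weak separation into a uniform
    gap.\<close>
  obtain \<delta> where \<delta>: "\<delta> > 0" "(a, \<alpha>, r) + \<delta> *\<^sub>R ((v0, k0, s0) - (a, \<alpha>, r)) \<in> N" using abs by blast
  define \<eta> where "\<eta> = \<delta> * (F (v0, k0, s0) - F (a, \<alpha>, r))"
  have gap: "F (a, \<alpha>, r) + \<eta> \<le> F p" if "p \<in> A" for p
    using FN[OF \<delta>(2) that]
    by (simp only: linear_add[OF F] linear_cmul[OF F] linear_diff[OF F] \<eta>_def real_scaleR_def)
  show ?thesis
  proof (rule that[OF fd b0])
    show "0 < \<eta>" using \<delta>(1) Flt by (simp add: \<eta>_def)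
    fix v k s assume k: "k \<in> dual tau" "h (v, k) \<le> ereal s"
    then have "F (a, \<alpha>, r) + \<eta> \<le> F (v, k, s)" by (intro gap) (simp add: A_def)
    then show "f a + \<alpha> u + b * r + \<eta> \<le> f v + k u + b * s"
      using u[OF dual_linear[OF \<alpha>]] u[OF dual_linear[OF k(1)]] by (simp add: dec)
  qed
qed

text \<open>This is \<open>h\<close> below its biconjugate. If \<open>h\<close> exceeded
  \<open>r\<close> at \<open>(a, \<alpha>)\<close>, a hyperplane separating the epigraph from that
  point would produce an affine minorant above \<open>r\<close> there.\<close>

theorem Fenchel_Moreau_le:
  assumes lcs: "lcs tau" and pr: "proper_fun tau h" and cv: "convex_fun tau h" and lsc: "lsc_fun tau h"
    and min: "affine_minorant tau h u0 g0 \<beta>0" and \<alpha>: "\<alpha> \<in> dual tau"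
    and bd: "\<And>u g \<beta>. affine_minorant tau h u g \<beta> \<Longrightarrow> \<alpha> u + g a - \<beta> \<le> r"
  shows "h (a, \<alpha>) \<le> ereal r"
proof (rule ccontr)
  assume "\<not> h (a, \<alpha>) \<le> ereal r"
  then have "ereal r < h (a, \<alpha>)" by simp
  from affine_separation_from_epigraph[OF lcs pr cv lsc \<alpha> this]
  obtain u f b \<eta> where f: "f \<in> dual tau" and b: "0 \<le> b" and \<eta>: "0 < \<eta>"
    and sep: "\<And>v k s. k \<in> dual tau \<Longrightarrow> h (v, k) \<le> ereal s \<Longrightarrow> f a + \<alpha> u + b * r + \<eta> \<le> f v + k u + b * s"
    by metis
  have g0: "g0 \<in> dual tau" and m0: "\<And>x k. k \<in> dual tau \<Longrightarrow> ereal (k u0 + g0 x - \<beta>0) \<le> h (x, k)"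
    using min by (auto simp: affine_minorant_def)
  have fin: "h (x, k) = \<infinity> \<or> (\<exists>s. h (x, k) = ereal s)" if "k \<in> dual tau" for x k
    using m0[OF that, of x] by (cases "h (x, k)") auto
  show False
  proof (cases "b = 0")
    case True
    \<comment> \<open>A vertical hyperplane: add a large multiple of it to the given minorant.\<close>
    define t where "t = (r - (\<alpha> u0 + g0 a - \<beta>0)) / \<eta>"
    define l where "l = max 0 t + 1"
    define \<beta> where "\<beta> = \<beta>0 - l * (f a + \<alpha> u + \<eta>)"
    have "affine_minorant tau h (u0 - l *\<^sub>R u) (\<lambda>y. 1 * g0 y + (- l) * f y) \<beta>"
      unfolding affine_minorant_def
    proof (intro conjI allI impI)
      show "(\<lambda>y. 1 * g0 y + (- l) * f y) \<in> dual tau" by (rule dual_combination[OF g0 f])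
      fix x k assume k: "k \<in> dual tau"
      show "ereal (k (u0 - l *\<^sub>R u) + (1 * g0 x + (- l) * f x) - \<beta>) \<le> h (x, k)"
        using fin[OF k, of x]
      proof
        assume "\<exists>s. h (x, k) = ereal s"
        then obtain s where s: "h (x, k) = ereal s" by blast
        have "f a + \<alpha> u + \<eta> \<le> f x + k u" using sep[OF k, of x s] s True by simp
        then have "l * (f a + \<alpha> u + \<eta>) \<le> l * (f x + k u)"
          by (intro mult_left_mono) (auto simp: l_def)
        moreover have "k u0 + g0 x - \<beta>0 \<le> s" using m0[OF k, of x] s by simp
        ultimately show ?thesis
          using dual_linear[OF k] by (simp add: s \<beta>_def linear_diff linear_cmul algebra_simps)
      qed simp
    qed
    from bd[OF this] have "(\<alpha> u0 + g0 a - \<beta>0) + l * \<eta> \<le> r"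
      using dual_linear[OF \<alpha>] by (simp add: \<beta>_def linear_diff linear_cmul algebra_simps)
    then have "l \<le> t" using \<eta> by (simp add: t_def field_simps)
    then show False by (simp add: l_def)
  next
    case False
    then have b: "b > 0" using b by simp
    \<comment> \<open>Solving the separating inequality for \<open>s\<close> gives a minorant whose
      value at \<open>(a, \<alpha>)\<close> is \<open>r + \<eta> / b\<close>.\<close>
    define \<beta> where "\<beta> = - (f a + \<alpha> u + \<eta>) / b - r"
    have "affine_minorant tau h ((- 1 / b) *\<^sub>R u) (\<lambda>y. (- 1 / b) * f y + 0 * f y) \<beta>"
      unfolding affine_minorant_def
    proof (intro conjI allI impI)
      show "(\<lambda>y. (- 1 / b) * f y + 0 * f y) \<in> dual tau" by (rule dual_combination[OF f f])
      fix x k assume k: "k \<in> dual tau"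
      show "ereal (k ((- 1 / b) *\<^sub>R u) + ((- 1 / b) * f x + 0 * f x) - \<beta>) \<le> h (x, k)"
        using fin[OF k, of x]
      proof
        assume "\<exists>s. h (x, k) = ereal s"
        then obtain s where s: "h (x, k) = ereal s" by blast
        have "f a + \<alpha> u + b * r + \<eta> \<le> f x + k u + b * s" using sep[OF k, of x s] s by simp
        then have "f a + \<alpha> u + \<eta> - f x - k u \<le> (s - r) * b" by (simp add: algebra_simps)
        then have "(f a + \<alpha> u + \<eta> - f x - k u) / b \<le> s - r"
          using b by (simp only: pos_divide_le_eq)
        then have "(- 1 / b) * k u + ((- 1 / b) * f x + 0 * f x) - \<beta> \<le> s"
          by (simp add: \<beta>_def add_divide_distrib diff_divide_distrib)
        then show ?thesis
          using linear_cmul[OF dual_linear[OF k], of "- 1 / b" u] by (simp add: s)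
      qed simp
    qed
    from bd[OF this] have "r + \<eta> / b \<le> r"
      using b linear_cmul[OF dual_linear[OF \<alpha>], of "- 1 / b" u]
      by (simp add: \<beta>_def add_divide_distrib diff_divide_distrib)
    then show False using divide_pos_pos[OF \<eta> b] by simp
  qed
qed


lemma affine_minorant_mono:
  assumes "affine_minorant tau h u g \<beta>" "\<beta> \<le> \<beta>'"
  shows "affine_minorant tau h u g \<beta>'"
  unfolding affine_minorant_def
proof (intro conjI allI impI)
  show "g \<in> dual tau" using assms by (simp add: affine_minorant_def)
  fix x k assume "k \<in> dual tau"
  then have "ereal (k u + g x - \<beta>) \<le> h (x, k)" using assms by (simp add: affine_minorant_def)
  then show "ereal (k u + g x - \<beta>') \<le> h (x, k)"
    by (rule order_trans[rotated]) (use assms(2) in simp)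
qed

text \<open>A convex combination of two minorants lies below their maximum, hence below
  \<open>h\<close>; no arithmetic with infinite values arises.\<close>

lemma affine_minorant_convex:
  assumes 1: "affine_minorant tau h u g \<beta>" and 2: "affine_minorant tau h u' g' \<beta>'"
    and st: "0 \<le> s" "0 \<le> t" "s + t = 1"
  shows "affine_minorant tau h (s *\<^sub>R u + t *\<^sub>R u') (\<lambda>y. s * g y + t * g' y) (s * \<beta> + t * \<beta>')"
  unfolding affine_minorant_def
proof (intro conjI allI impI)
  show "(\<lambda>y. s * g y + t * g' y) \<in> dual tau"
    using 1 2 by (intro dual_combination) (auto simp: affine_minorant_def)
  fix x k assume k: "k \<in> dual tau"
  let ?p = "k u + g x - \<beta>" and ?q = "k u' + g' x - \<beta>'"
  have "s * ?p + t * ?q \<le> max ?p ?q"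
    using st by (intro convex_bound_le) auto
  then have "ereal (s * ?p + t * ?q) \<le> ereal (max ?p ?q)" by (simp only: ereal_less_eq)
  also have "\<dots> \<le> h (x, k)"
    using 1 2 k by (simp add: affine_minorant_def max_def)
  finally have "ereal (s * ?p + t * ?q) \<le> h (x, k)" .
  moreover have "k (s *\<^sub>R u + t *\<^sub>R u') = s * k u + t * k u'"
    using dual_linear[OF k] by (simp add: linear_add linear_cmul)
  ultimately show "ereal (k (s *\<^sub>R u + t *\<^sub>R u') + (s * g x + t * g' x) - (s * \<beta> + t * \<beta>')) \<le> h (x, k)"
    by (simp add: algebra_simps)
qed

section \<open>Contact with the coupling function\<close>

text \<open>A convex function above the coupling that touches it at \<open>(x, \<zeta>)\<close> lies above the derivative of
  the coupling at \<open>(x, \<zeta>)\<close>.\<close>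
lemma coupling_tangent:
  assumes g: "linear g" and \<zeta>: "linear \<zeta>"
    and le: "\<And>l::real. 0 < l \<Longrightarrow> l < 1 \<Longrightarrow>
      cpl (l *\<^sub>R u + (1 - l) *\<^sub>R x, \<lambda>y. l * g y + (1 - l) * \<zeta> y) \<le> l * \<beta> + (1 - l) * \<zeta> x"
  shows "g x + \<zeta> u - \<zeta> x \<le> \<beta>"
proof (rule ccontr)
  assume "\<not> g x + \<zeta> u - \<zeta> x \<le> \<beta>"
  then have pos: "0 < g x + \<zeta> u - \<zeta> x - \<beta>" by simp
  \<comment> \<open>\<open>D\<close> is \<open>(g - \<zeta>)(u - x)\<close>, the coefficient of the
    square of \<open>l\<close> in the coupling along the segment. For small \<open>l\<close> it
    cannot compensate the assumed gap.\<close>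
  define D where "D = g u - (g x + \<zeta> u) + \<zeta> x"
  obtain \<delta> where \<delta>: "\<delta> > 0" "\<And>t. 0 \<le> t \<Longrightarrow> t \<le> \<delta> \<Longrightarrow> t * \<bar>D\<bar> < g x + \<zeta> u - \<zeta> x - \<beta>"
    using small_scaling[OF pos] by blast
  define l where "l = min \<delta> (1/2)"
  have l: "0 < l" "l < 1" "l \<le> \<delta>" using \<delta>(1) by (auto simp: l_def)
  have "l * (l * g u + (1 - l) * g x) + (1 - l) * (l * \<zeta> u + (1 - l) * \<zeta> x) \<le> l * \<beta> + (1 - l) * \<zeta> x"
    using le[OF l(1,2)] by (simp add: cpl_def linear_add[OF g] linear_add[OF \<zeta>] linear_cmul[OF g] linear_cmul[OF \<zeta>])
  then have "l * (l * D + (g x + \<zeta> u) - \<zeta> x) \<le> l * \<beta>"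
    by (simp add: D_def algebra_simps)
  then have "l * D + (g x + \<zeta> u) - \<zeta> x \<le> \<beta>" using l(1) by simp
  moreover have "- (l * D) \<le> l * \<bar>D\<bar>" using l(1) by (metis abs_ge_minus_self mult_le_cancel_left_pos mult_minus_right)
  ultimately show False using \<delta>(2)[of l] l by linarith
qed

text \<open>Contact points of \<open>h\<close> and the coupling thus yield points of the conjugate's
  epigraph; the interior point of the domain enters the duality argument this way.\<close>

lemma affine_minorant_contact:
  assumes cv: "convex_fun tau h" and ge: "\<And>z. z \<in> Zspace tau \<Longrightarrow> ereal (cpl z) \<le> h z"
    and \<zeta>: "\<zeta> \<in> dual tau" and eq: "h (x, \<zeta>) = ereal (\<zeta> x)"
  shows "affine_minorant tau h x \<zeta> (\<zeta> x)"
  unfolding affine_minorant_def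
proof (intro conjI allI impI \<zeta>)
  fix u g assume g: "g \<in> dual tau"
  show "ereal (g x + \<zeta> u - \<zeta> x) \<le> h (u, g)"
  proof (cases "h (u, g)")
    case (real \<beta>)
    have "g x + \<zeta> u - \<zeta> x \<le> \<beta>"
    proof (rule coupling_tangent[OF dual_linear[OF g] dual_linear[OF \<zeta>]])
      fix l :: real assume l: "0 < l" "l < 1"
      let ?w = "(l *\<^sub>R u + (1 - l) *\<^sub>R x, \<lambda>y. l * g y + (1 - l) * \<zeta> y)"
      have "ereal (cpl ?w) \<le> h ?w"
        using dual_combination[OF g \<zeta>] by (intro ge) (simp add: Zspace_def)
      also have "\<dots> \<le> ereal l * h (u, g) + ereal (1 - l) * h (x, \<zeta>)"
        using cv[unfolded convex_fun_def Zspace_def, rule_format, of "(u, g)" "(x, \<zeta>)" l] g \<zeta> l by simp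
      finally show "cpl ?w \<le> l * \<beta> + (1 - l) * \<zeta> x" by (simp add: real eq)
    qed
    then show ?thesis by (simp add: real)
  next
    case MInf
    then show ?thesis using ge[of "(u, g)"] g by (simp add: Zspace_def)
  qed simp
qed

lemma phi_le_iff:
  "phi T (x, k) \<le> ereal r \<longleftrightarrow> (\<forall>(u, g)\<in>T. k u + g x - g u \<le> r)"
  by (auto simp: phi_def SUP_le_iff)

text \<open>The tangent argument with the Fitzpatrick function, a supremum of affine functions, in
  place of \<open>h\<close>. Convexity of \<open>C\<close> keeps the segment where the lower bound
  holds.\<close>

lemma NI_tangent:
  assumes NI: "NI tau C T" and T: "T \<subseteq> UNIV \<times> dual tau" and C: "convex C"
    and x: "x \<in> C" "\<zeta> \<in> dual tau" "phi (restr T C) (x, \<zeta>) \<le> ereal (\<zeta> x)"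
    and u: "u \<in> C" "g \<in> dual tau" "phi (restr T C) (u, g) \<le> ereal \<beta>"
  shows "g x + \<zeta> u - \<zeta> x \<le> \<beta>"
proof (rule coupling_tangent[OF dual_linear[OF u(2)] dual_linear[OF x(2)]])
  fix l :: real assume l: "0 < l" "l < 1"
  let ?w = "(l *\<^sub>R u + (1 - l) *\<^sub>R x, \<lambda>y. l * g y + (1 - l) * \<zeta> y)"
  have "l *\<^sub>R u + (1 - l) *\<^sub>R x \<in> C" using l u(1) x(1) by (intro convexD[OF C]) auto
  then have "ereal (cpl ?w) \<le> phi (restr T C) ?w"
    using NI dual_combination[OF u(2) x(2)] unfolding NI_def by blast
  also have "\<dots> \<le> ereal (l * \<beta> + (1 - l) * \<zeta> x)"
    unfolding phi_le_iff
  proof (clarify)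
    fix v k assume vk: "(v, k) \<in> restr T C"
    then have "k \<in> dual tau" using T by (auto simp: restr_def)
    note k = dual_linear[OF this]
    have "g v + k u - k v \<le> \<beta>" "\<zeta> v + k x - k v \<le> \<zeta> x"
      using x(3) u(3) vk unfolding phi_le_iff by auto
    then have "l * (g v + k u - k v) + (1 - l) * (\<zeta> v + k x - k v) \<le> l * \<beta> + (1 - l) * \<zeta> x"
      using l by (intro add_mono mult_left_mono) auto
    moreover have "k (l *\<^sub>R u + (1 - l) *\<^sub>R x) = l * k u + (1 - l) * k x"
      by (simp add: linear_add[OF k] linear_cmul[OF k])
    ultimately show "l * g v + (1 - l) * \<zeta> v + k (l *\<^sub>R u + (1 - l) *\<^sub>R x) - k v \<le> l * \<beta> + (1 - l) * \<zeta> x"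
      by (simp add: algebra_simps)
  qed
  finally show "cpl ?w \<le> l * \<beta> + (1 - l) * \<zeta> x" by simp
qed

text \<open>The interior point makes the value function of the perturbed problem
  \<open>inf {h\<^sup>*(w) - \<langle>z, w\<rangle> | w \<in> (C - v) \<times> X\<^sup>*}\<close> bounded above near \<open>v = 0\<close>, so it has a continuous
  subgradient \<open>n\<close> at \<open>0\<close>.\<close>
lemma normal_multiplier_exists:
  assumes lcs: "lcs tau" and C: "convex C" and u0: "u0 \<in> tau interior_of C"
    and m0: "affine_minorant tau h u0 g0 \<beta>0" and \<zeta>: "\<zeta> \<in> dual tau"
    and key: "\<And>u g \<beta>. affine_minorant tau h u g \<beta> \<Longrightarrow> u \<in> C \<Longrightarrow> g x + \<zeta> u - \<zeta> x \<le> \<beta>"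
  obtains n where "n \<in> dual tau"
    "\<And>u g \<beta> y. affine_minorant tau h u g \<beta> \<Longrightarrow> y \<in> C \<Longrightarrow> n (y - u) \<le> \<beta> - g x - \<zeta> u + \<zeta> x"
proof -
  note l\<zeta> = dual_linear[OF \<zeta>]
  \<comment> \<open>Pairs of a perturbation and the cost of a feasible choice; \<open>key\<close>
    says that the cost is nonnegative at perturbation 0, so \<open>B\<close> misses the negative ray
    \<open>A\<close>.\<close>
  define B where "B = {(y - u, \<beta> - g x - \<zeta> u + \<zeta> x) |u g \<beta> y. affine_minorant tau h u g \<beta> \<and> y \<in> C}"
  define A :: "('a \<times> real) set" where "A = {0} \<times> {..<0}"
  have BI: "(y - u, \<beta> - g x - \<zeta> u + \<zeta> x) \<in> B" if "affine_minorant tau h u g \<beta>" "y \<in> C" for u g \<beta> y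
    using that unfolding B_def by blast
  have cB: "convex B"
  proof (rule convexI)
    fix p q :: "'a \<times> real" and s t :: real
    assume p: "p \<in> B" and q: "q \<in> B" and st: "0 \<le> s" "0 \<le> t" "s + t = 1"
    obtain u g \<beta> y where p': "p = (y - u, \<beta> - g x - \<zeta> u + \<zeta> x)" "affine_minorant tau h u g \<beta>" "y \<in> C"
      using p unfolding B_def by blast
    obtain u' g' \<beta>' y' where q': "q = (y' - u', \<beta>' - g' x - \<zeta> u' + \<zeta> x)" "affine_minorant tau h u' g' \<beta>'" "y' \<in> C"
      using q unfolding B_def by blast
    have "s *\<^sub>R y + t *\<^sub>R y' \<in> C" using st p' q' by (intro convexD[OF C]) auto
    note BI[OF affine_minorant_convex[OF p'(2) q'(2) st] this]
    moreover have "\<zeta> x = s * \<zeta> x + t * \<zeta> x" using st by (metis distrib_right mult_1)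
    ultimately show "s *\<^sub>R p + t *\<^sub>R q \<in> B"
      by (simp add: p'(1) q'(1) linear_add[OF l\<zeta>] linear_cmul[OF l\<zeta>] algebra_simps)
  qed
  have cA: "convex A" unfolding A_def by (intro convex_Times) auto
  have disj: "B \<inter> A = {}"
  proof -
    have False if "affine_minorant tau h u g \<beta>" "y \<in> C" "y - u = 0" "\<beta> - g x - \<zeta> u + \<zeta> x < 0" for u g \<beta> y
      using key[OF that(1)] that(2-4) by simp
    then show ?thesis unfolding A_def B_def by blast
  qed
  \<comment> \<open>The cost at the interior point, raised by one: the extra unit leaves vertical
    room in \<open>B\<close>, and the interior of \<open>C\<close> leaves horizontal room.\<close>
  define s0 where "s0 = \<beta>0 + 1 - g0 x - \<zeta> u0 + \<zeta> x"
  have u0C: "u0 \<in> C" by (rule subsetD[OF interior_of_subset u0])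
  have s0: "1 \<le> s0" using key[OF m0 u0C] by (simp add: s0_def)
  have ab: "\<exists>\<delta>>0. (0, s0) + \<delta> *\<^sub>R d \<in> B" for d
  proof -
    obtain d1 d2 where d: "d = (d1, d2)" by (cases d)
    obtain p where p: "p > 0" "\<And>t. \<bar>t\<bar> \<le> p \<Longrightarrow> u0 + t *\<^sub>R d1 \<in> tau interior_of C"
      using lcs_open_absorbing[OF lcs openin_interior_of u0] by blast
    obtain q where q: "q > 0" "\<And>t. 0 \<le> t \<Longrightarrow> t \<le> q \<Longrightarrow> t * \<bar>d2\<bar> < 1"
      using small_scaling[of 1 d2] by auto
    define \<delta> where "\<delta> = min p q"
    have \<delta>: "\<delta> > 0" "\<delta> \<le> p" "\<delta> \<le> q" using p q by (auto simp: \<delta>_def)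
    have "u0 + \<delta> *\<^sub>R d1 \<in> C" using subsetD[OF interior_of_subset p(2)[of \<delta>]] \<delta> by simp
    moreover have "- (\<delta> * d2) \<le> \<delta> * \<bar>d2\<bar>"
      using \<delta>(1) by (metis abs_ge_minus_self mult_le_cancel_left_pos mult_minus_right)
    then have "\<beta>0 \<le> \<beta>0 + 1 + \<delta> * d2" using q(2)[of \<delta>] \<delta> by linarith
    from affine_minorant_mono[OF m0 this] have "affine_minorant tau h u0 g0 (\<beta>0 + 1 + \<delta> * d2)" .
    ultimately have "(u0 + \<delta> *\<^sub>R d1 - u0, (\<beta>0 + 1 + \<delta> * d2) - g0 x - \<zeta> u0 + \<zeta> x) \<in> B" by (intro BI)
    then show ?thesis using \<delta>(1) by (intro exI[of _ \<delta>]) (simp add: d s0_def algebra_simps)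
  qed
  have a0: "(0, - 1) \<in> A" by (simp add: A_def)
  obtain F where F: "linear F" and FB: "\<And>p q. p \<in> B \<Longrightarrow> q \<in> A \<Longrightarrow> F p \<le> (F q :: real)"
    and Flt: "F (0, s0) < F (0, - 1)"
    using convex_separation[OF cB cA disj a0 ab] by metis
  define f where "f v = F (v, 0)" for v
  define c where "c = F (0, 1)"
  have lf: "linear f" unfolding f_def
    using linear_add[OF F, of "(_, 0)" "(_, 0)"] linear_cmul[OF F, of _ "(_, 0)"]
    by (intro linearI) simp_all
  have dec: "F (v, s) = f v + c * s" for v s
  proof -
    have "F (v, s) = F ((v, 0) + s *\<^sub>R (0, 1))" by simp
    also have "\<dots> = f v + s * c"
      by (simp only: linear_add[OF F] linear_cmul[OF F] f_def c_def real_scaleR_def)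
    finally show ?thesis by simp
  qed
  have "c * (s0 + 1) < 0" using Flt linear_0[OF lf] by (simp add: dec algebra_simps)
  then have c: "c < 0" using s0 by (simp add: mult_less_0_iff)
  \<comment> \<open>Since \<open>c < 0\<close>, the values of \<open>F\<close> on \<open>A\<close>
    are positive but arbitrarily close to 0; halving a positive value on \<open>B\<close> exhibits a
    smaller one on \<open>A\<close>.\<close>
  have fB: "f v + c * s \<le> 0" if "(v, s) \<in> B" for v s
  proof (rule ccontr)
    assume "\<not> f v + c * s \<le> 0"
    then have e: "0 < f v + c * s" by simp
    then have "(0, (f v + c * s) / (2 * c)) \<in> A" using c by (simp add: A_def divide_pos_neg)
    from FB[OF that this] have "f v + c * s \<le> (f v + c * s) / 2"
      using c linear_0[OF lf] by (simp add: dec)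
    then show False using e by simp
  qed
  define V where "V = {d \<in> topspace tau. u0 + 1 *\<^sub>R d \<in> tau interior_of C}"
  have "openin tau V"
    unfolding V_def by (rule openin_continuous_map_preimage[OF lcs_continuous_affine(1)[OF lcs] openin_interior_of])
  moreover have "0 \<in> V" using u0 lcs by (simp add: V_def lcs_def)
  moreover have "f d \<le> - (c * s0)" if "d \<in> V" for d
  proof -
    have "u0 + d \<in> C" using that subsetD[OF interior_of_subset, of "u0 + d" tau C] by (simp add: V_def)
    moreover have "affine_minorant tau h u0 g0 (\<beta>0 + 1)" by (rule affine_minorant_mono[OF m0]) simp
    ultimately have "(u0 + d - u0, \<beta>0 + 1 - g0 x - \<zeta> u0 + \<zeta> x) \<in> B" by (intro BI)
    then have "(d, s0) \<in> B" by (simp add: s0_def)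
    from fB[OF this] show ?thesis by simp
  qed
  ultimately have fd: "f \<in> dual tau" by (rule dualI_bounded_above[OF lcs lf])
  show ?thesis
  proof (rule that)
    show "(\<lambda>y. (- 1 / c) * f y + 0 * f y) \<in> dual tau" by (rule dual_combination[OF fd fd])
    fix u g \<beta> y assume "affine_minorant tau h u g \<beta>" "y \<in> C"
    from fB[OF BI[OF this]] have "f (y - u) \<le> (\<beta> - g x - \<zeta> u + \<zeta> x) * (- c)"
      by (simp add: mult.commute)
    then have "f (y - u) / (- c) \<le> \<beta> - g x - \<zeta> u + \<zeta> x"
      using c by (subst pos_divide_le_eq) auto
    then show "(- 1 / c) * f (y - u) + 0 * f (y - u) \<le> \<beta> - g x - \<zeta> u + \<zeta> x" by simp
  qed
qed

lemma NI_imp_le_c_subset_plus_normal: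
  assumes lcs: "lcs tau" and T: "T \<subseteq> UNIV \<times> dual tau" and C: "convex C"
    and int: "dom_op T \<inter> (tau interior_of C) \<noteq> {}"
    and rep: "representable tau C T" and NI: "NI tau C T"
  shows "le_c tau (phi (restr T C)) \<inter> (C \<times> dual tau) \<subseteq> plus_normal tau T C"
proof clarify
  fix x \<zeta> assume le: "(x, \<zeta>) \<in> le_c tau (phi (restr T C))" and x: "x \<in> C" and \<zeta>: "\<zeta> \<in> dual tau"
  have ph: "phi (restr T C) (x, \<zeta>) \<le> ereal (\<zeta> x)" using le by (simp add: le_c_def cpl_def)
  obtain h where pr: "proper_fun tau h" and cv: "convex_fun tau h" and lsc: "lsc_fun tau h"
    and ge: "\<And>z. z \<in> Zspace tau \<Longrightarrow> ereal (cpl z) \<le> h z"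
    and eq: "{z \<in> C \<times> dual tau. h z = ereal (cpl z)} = restr T C"
    using rep unfolding representable_def by blast
  have hT: "h (v, k) = ereal (k v)" if "(v, k) \<in> restr T C" for v k
  proof -
    have "(v, k) \<in> {z \<in> C \<times> dual tau. h z = ereal (cpl z)}" unfolding eq by (rule that)
    then show ?thesis by (simp add: cpl_def)
  qed
  obtain u0 g0 where u0: "u0 \<in> tau interior_of C" and t0: "(u0, g0) \<in> T"
    using int by (force simp: dom_op_def)
  have u0C: "u0 \<in> C" by (rule subsetD[OF interior_of_subset u0])
  have r0: "(u0, g0) \<in> restr T C" using t0 u0C by (simp add: restr_def)
  have g0: "g0 \<in> dual tau" using T t0 by auto
  have m0: "affine_minorant tau h u0 g0 (g0 u0)"
    by (rule affine_minorant_contact[OF cv ge g0 hT[OF r0]])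
  have key: "g x + \<zeta> u - \<zeta> x \<le> \<beta>" if m: "affine_minorant tau h u g \<beta>" and u: "u \<in> C" for u g \<beta>
  proof (rule NI_tangent[OF NI T C x \<zeta> ph u])
    show "g \<in> dual tau" using m by (simp add: affine_minorant_def)
    \<comment> \<open>On the restricted graph \<open>h\<close> equals the coupling, so the minorant
      inequality there is exactly the bound on the Fitzpatrick function.\<close>
    show "phi (restr T C) (u, g) \<le> ereal \<beta>"
      unfolding phi_le_iff
    proof clarify
      fix v k assume vk: "(v, k) \<in> restr T C"
      then have "k \<in> dual tau" using T by (auto simp: restr_def)
      then have "ereal (k u + g v - \<beta>) \<le> h (v, k)" using m by (simp add: affine_minorant_def)
      then show "g v + k u - k v \<le> \<beta>" by (simp add: hT[OF vk])
    qed
  qed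
  obtain n where n: "n \<in> dual tau"
    and mult: "\<And>u g \<beta> y. affine_minorant tau h u g \<beta> \<Longrightarrow> y \<in> C \<Longrightarrow> n (y - u) \<le> \<beta> - g x - \<zeta> u + \<zeta> x"
    using normal_multiplier_exists[where x = x, OF lcs C u0 m0 \<zeta>] key by metis
  note ln = dual_linear[OF n]
  define \<xi> where "\<xi> = (\<lambda>y. 1 * \<zeta> y + (- 1) * n y)"
  have \<xi>: "\<xi> \<in> dual tau" unfolding \<xi>_def by (rule dual_combination[OF \<zeta> n])
  \<comment> \<open>The multiplier inequality bounds every affine minorant at
    \<open>(x, \<xi>)\<close>, so biconjugation bounds \<open>h\<close> itself.\<close>
  have FM: "h (x, \<xi>) \<le> ereal (\<zeta> x - n y)" if y: "y \<in> C" for y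
  proof (rule Fenchel_Moreau_le[OF lcs pr cv lsc m0 \<xi>])
    fix u g \<beta> assume "affine_minorant tau h u g \<beta>"
    from mult[OF this y] show "\<xi> u + g x - \<beta> \<le> \<zeta> x - n y"
      by (simp add: \<xi>_def linear_diff[OF ln])
  qed
  have ge\<xi>: "ereal (\<zeta> x - n x) \<le> h (x, \<xi>)"
    using ge[of "(x, \<xi>)"] \<xi> by (simp add: Zspace_def cpl_def \<xi>_def)
  have "h (x, \<xi>) = ereal (cpl (x, \<xi>))"
    using FM[OF x] ge\<xi> by (simp add: cpl_def \<xi>_def)
  then have "(x, \<xi>) \<in> restr T C" using x \<xi> unfolding eq[symmetric] by simp
  then have "(x, \<xi>) \<in> T" by (simp add: restr_def)
  moreover have "n \<in> normal_cone tau C x"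
  proof -
    have "n (y - x) \<le> 0" if "y \<in> C" for y
      using order_trans[OF ge\<xi> FM[OF that]] by (simp add: linear_diff[OF ln])
    then show ?thesis using n x by (simp add: normal_cone_def)
  qed
  moreover have "\<zeta> = (\<lambda>y. \<xi> y + n y)" by (simp add: \<xi>_def)
  ultimately show "(x, \<zeta>) \<in> plus_normal tau T C" unfolding plus_normal_def by blast
qed

section \<open>The elementary implications and the normal cone\<close>

text \<open>A point violating NI would have \<open>x\<close> in the domain, and any \<open>k\<close>
  in \<open>T x\<close> contributes \<open>\<zeta> x + k x - k x\<close>, the coupling itself, to
  the supremum.\<close>

lemma locates_imp_NI:
  assumes loc: "locates tau C T"
  shows "NI tau C T"
  unfolding NI_def
proof clarify
  fix x \<zeta> assume x: "x \<in> C" and \<zeta>: "\<zeta> \<in> dual tau"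
  show "ereal (cpl (x, \<zeta>)) \<le> phi (restr T C) (x, \<zeta>)"
  proof (rule ccontr)
    assume "\<not> ereal (cpl (x, \<zeta>)) \<le> phi (restr T C) (x, \<zeta>)"
    then have lt: "phi (restr T C) (x, \<zeta>) < ereal (cpl (x, \<zeta>))" by simp
    then have "(x, \<zeta>) \<in> le_c tau (phi (restr T C))" using \<zeta> by (simp add: le_c_def Zspace_def)
    then have "x \<in> fst ` le_c tau (phi (restr T C)) \<inter> C" using x by force
    then obtain k where "(x, k) \<in> T" using loc unfolding locates_def dom_op_def by force
    then have "(x, k) \<in> restr T C" using x by (simp add: restr_def)
    then have "ereal (\<zeta> x + k x - k x) \<le> phi (restr T C) (x, \<zeta>)"
      unfolding phi_def by (rule SUP_upper2) simp
    then show False using lt by (simp add: cpl_def)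
  qed
qed

lemma le_c_subset_plus_normal_imp_locates:
  assumes "le_c tau (phi (restr T C)) \<inter> (C \<times> dual tau) \<subseteq> plus_normal tau T C"
  shows "locates tau C T"
  unfolding locates_def
proof clarify
  fix x \<zeta> assume "(x, \<zeta>) \<in> le_c tau (phi (restr T C))" "fst (x, \<zeta>) \<in> C"
  then have "(x, \<zeta>) \<in> plus_normal tau T C"
    using assms by (auto simp: le_c_def Zspace_def)
  then obtain k where "(x, k) \<in> T" unfolding plus_normal_def by blast
  then show "fst (x, \<zeta>) \<in> dom_op T" by (force simp: dom_op_def)
qed

text \<open>A normal \<open>n\<close> at \<open>u\<close> changes the term of \<open>(u, g)\<close>
  by \<open>n (x - u) \<le> 0\<close>, and the zero normal retains the original terms.\<close>

lemma phi_plus_normal: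
  assumes x: "x \<in> C"
  shows "phi (restr (plus_normal tau T C) C) (x, \<zeta>) = phi (restr T C) (x, \<zeta>)"
proof (rule antisym)
  show "phi (restr (plus_normal tau T C) C) (x, \<zeta>) \<le> phi (restr T C) (x, \<zeta>)"
    unfolding phi_def
  proof (rule SUP_least)
    fix p assume "p \<in> restr (plus_normal tau T C) C"
    then obtain u g n where p: "p = (u, \<lambda>y. g y + n y)" "(u, g) \<in> T" "n \<in> normal_cone tau C u" "u \<in> C"
      by (auto simp: restr_def plus_normal_def)
    have n: "n \<in> dual tau" "n (x - u) \<le> 0" using p(3,4) x by (auto simp: normal_cone_def)
    then have "n x \<le> n u" using linear_diff[OF dual_linear[OF n(1)], of x u] by simp
    then show "ereal (snd (x, \<zeta>) (fst p) + snd p (fst (x, \<zeta>)) - snd p (fst p))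
        \<le> (SUP p\<in>restr T C. ereal (snd (x, \<zeta>) (fst p) + snd p (fst (x, \<zeta>)) - snd p (fst p)))"
      using p by (intro SUP_upper2[of "(u, g)"]) (auto simp: restr_def)
  qed
  have "(\<lambda>y. 0) \<in> normal_cone tau C u" if "u \<in> C" for u
    using that by (simp add: normal_cone_def dual_def module_hom_zero)
  then have "restr T C \<subseteq> restr (plus_normal tau T C) C"
    unfolding restr_def plus_normal_def by force
  then show "phi (restr T C) (x, \<zeta>) \<le> phi (restr (plus_normal tau T C) C) (x, \<zeta>)"
    unfolding phi_def by (rule SUP_subset_mono) simp
qed

lemma identifies_plus_normal_iff:
  "identifies tau C (plus_normal tau T C) \<longleftrightarrow>
     le_c tau (phi (restr T C)) \<inter> (C \<times> dual tau) \<subseteq> plus_normal tau T C"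
proof -
  have "le_c tau (phi (restr (plus_normal tau T C) C)) \<inter> (C \<times> dual tau)
      = le_c tau (phi (restr T C)) \<inter> (C \<times> dual tau)"
    by (auto simp: le_c_def phi_plus_normal)
  then show ?thesis by (simp add: identifies_def)
qed

theorem theorem3p9:
  fixes tau :: "'a::real_vector topology" and T :: "'a op" and C :: "'a set"
  assumes "lcs tau"
    and "\<exists>x::'a. x \<noteq> 0"
    and "T \<subseteq> UNIV \<times> dual tau"
    and "closedin tau C" and "convex C"
    and "dom_op T \<inter> (tau interior_of C) \<noteq> {}"
    and "representable tau C T"
  shows "(locates tau C T \<longleftrightarrow> NI tau C T)
       \<and> (NI tau C T \<longleftrightarrow> le_c tau (phi (restr T C)) \<inter> (C \<times> dual tau) \<subseteq> plus_normal tau T C)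
       \<and> (le_c tau (phi (restr T C)) \<inter> (C \<times> dual tau) \<subseteq> plus_normal tau T C
            \<longleftrightarrow> identifies tau C (plus_normal tau T C))"
  \<comment> \<open>The cycle (i), (ii), (iii), (i) is closed; (iii) and (iv) agree because both
    Fitzpatrick functions coincide over \<open>C\<close>.\<close>
  using locates_imp_NI[of tau C T] le_c_subset_plus_normal_imp_locates[of tau T C]
    NI_imp_le_c_subset_plus_normal[OF assms(1,3,5,6,7)] identifies_plus_normal_iff[of tau C T]
  by argo

end
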